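(* Let $\underline{P}\succeq0$ be such that, for every $i\in\mathbb{M}$, $$\begin{bmatrix}A_i^\top\underline{P}A_i-\underline{P}+Q_i & A_i^\top\underline{P}B_i\\ B_i^\top\underline{P}A_i & R_i+B_i^\top\underline{P}B_i\end{bmatrix}\succeq0.$$ For every $d\in\mathbb{Z}_{\ge0}$ and $x\in\mathbb{R}^{n_x}$, the algorithm TROOP (described in the context) run with input $(x,d)$ terminates with finite budget $$\mathcal{B}\le\mathcal{B}^\star:=\frac{M^{d+1}-1}{M-1}+1$$ (for $M=1$ the fraction is read as $\sum_{k=0}^dM^k=d+1$). Moreover, the returned leaf $S$ satisfies $\bm{i}^{d,\star}(x)=\bm{i}(S)$ and $V_d^\star(x)=J(S)$; that is, the returned sequence $\bm{i}(S)$ has length $d$ and attains $V_d^\circ(x,\bm{i}(S))=V_d^\star(x)$, and the returned cost $J(S)$ equals $V_d^\star(x)$.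
   Context: Matrix inequalities: $A\succeq 0$ (resp. $A\succ0$) means $A$ is real, symmetric and positive semi-definite (resp. positive definite). System: $x^+=A_ix+B_iu$ with state $x\in\mathbb{R}^{n_x}$, continuous input $u\in\mathbb{R}^{n_u}$, discrete input $i\in\mathbb{M}:=\{1,\dots,M\}$, $n_x,n_u,M\in\mathbb{Z}_{>0}$. The matrices $A_i,B_i,Q_i,R_i$ are real of conformable dimensions, and $Q_i\succ0$, $R_i\succ0$ for all $i\in\mathbb{M}$. Stage cost: $\ell(x,u,i):=x^\top Q_ix+u^\top R_iu$. For input sequences $\bm{u}=(u_0,u_1,\dots)$ and $\bm{i}=(i_0,i_1,\dots)$, the solution is $\phi(0,x,\bm{u},\bm{i})=x$, $\phi(k+1,x,\bm{u},\bm{i})=A_{i_k}\phi(k,x,\bm{u},\bm{i})+B_{i_k}u_k$. Finite-horizon cost: with $J_0(x):=x^\top\underline{P}x$, for $d\in\mathbb{Z}_{\ge0}$ and sequences $\bm{u},\bm{i}$ of length $d$, $$J_d(x,\bm{u},\bm{i}):=\sum_{k=0}^{d-1}\ell(\phi(k,x,\bm{u},\bm{i}),u_k,i_k)+J_0(\phi(d,x,\bm{u},\bm{i})),\qquad V_d^\circ(x,\bm{i}):=\min_{\bm{u}}J_d(x,\bm{u},\bm{i}),$$ where the minimum is over $\bm{u}\in(\mathbb{R}^{n_u})^d$ only, with $V_0^\circ=J_0$. Also $V_d^\star(x):=\min_{\bm{i}\in\mathbb{M}^d}V_d^\circ(x,\bm{i})$, and $\bm{i}^{d,\star}(x)$ denotes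 a minimizing sequence, $V_d^\circ(x,\bm{i}^{d,\star}(x))=V_d^\star(x)$. Riccati operator of mode $i$: $\mathcal{R}_i(P):=Q_i+A_i^\top PA_i-A_i^\top PB_i(R_i+B_i^\top PB_i)^{-1}B_i^\top PA_i$. For a finite sequence $\bm{i}=(i_0,\dots,i_{k-1})$, $P_{\bm{i}}:=\mathcal{R}_{i_0}\circ\cdots\circ\mathcal{R}_{i_{k-1}}(\underline{P})$, with $P_\emptyset:=\underline{P}$ for the empty sequence. Algorithm TROOP, input $(x,d)$. It maintains a finite set $\mathcal{T}$ of leaves; each leaf $L$ carries a finite sequence of discrete inputs $\bm{i}(L)$, the matrix $P(L)=P_{\bm{i}(L)}$ and the cost $J(L)=x^\top P_{\bm{i}(L)}x$. Initialization: $j\leftarrow0$ and $\mathcal{T}$ contains the single leaf with empty sequence, matrix $\underline{P}$ and cost $x^\top\underline{P}x$. Repeat: (0) $j\leftarrow j+1$; (1) select $L_j\in\arg\min_{L\in\mathcal{T}}J(L)$ (ties broken arbitrarily) and remove $L_j$ from $\mathcal{T}$; (2) for each $i\in\mathbb{M}$, add to $\mathcal{T}$ the leaf with sequence $\bm{s}^i$ obtained by appending $i$ to $\bm{i}(L_j)$, matrix $P_{\bm{s}^i}$ and cost $x^\top P_{\bm{s}^i}x$; until the sequence $\bm{i}(L_j)$ has length $d$. Then set $S:=L_j$ and return the sequence $\bm{i}(S)$, the cost $J(S)$ and the budget $\mathcal{B}:=j$ (the number of leaf expansions). *)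

theory Defs
  imports "HOL-Analysis.Analysis"
begin

definition pos_semidef :: "real^'n^'n \<Rightarrow> bool" where
  "pos_semidef X \<longleftrightarrow> transpose X = X \<and> (\<forall>v. 0 \<le> v \<bullet> (X *v v))"

definition pos_def :: "real^'n^'n \<Rightarrow> bool" where
  "pos_def X \<longleftrightarrow> transpose X = X \<and> (\<forall>v. v \<noteq> 0 \<longrightarrow> 0 < v \<bullet> (X *v v))"

definition block_matrix ::
  "real^'n^'n \<Rightarrow> real^'m^'n \<Rightarrow> real^'n^'m \<Rightarrow> real^'m^'m \<Rightarrow> real^('n + 'm)^('n + 'm)" where
  "block_matrix X Y Z W = (\<chi> r c.
     (case r of
        Inl i \<Rightarrow> (case c of Inl j \<Rightarrow> X $ i $ j | Inr j \<Rightarrow> Y $ i $ j)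
      | Inr i \<Rightarrow> (case c of Inl j \<Rightarrow> Z $ i $ j | Inr j \<Rightarrow> W $ i $ j)))"

text \<open>The state space is indexed by \<open>'n\<close> and the continuous input space by \<open>'m\<close>.
  The modes are \<open>1, ..., num_modes\<close>; the matrices at other indices are irrelevant.\<close>

record ('n::finite, 'm::finite) switched_system =
  num_modes :: nat
  matA :: "nat \<Rightarrow> real^'n^'n"
  matB :: "nat \<Rightarrow> real^'m^'n"
  matQ :: "nat \<Rightarrow> real^'n^'n"
  matR :: "nat \<Rightarrow> real^'m^'m"

definition modes :: "('n::finite, 'm::finite) switched_system \<Rightarrow> nat set" where
  "modes sys = {1..num_modes sys}"

definition mode_seqs :: "('n::finite, 'm::finite) switched_system \<Rightarrow> nat \<Rightarrow> nat list set" where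
  "mode_seqs sys d = {is. length is = d \<and> set is \<subseteq> modes sys}"


subsection \<open>Optimal control problem\<close>

definition stage_cost ::
  "('n::finite, 'm::finite) switched_system \<Rightarrow> real^'n \<Rightarrow> real^'m \<Rightarrow> nat \<Rightarrow> real" where
  "stage_cost sys x u i = x \<bullet> (matQ sys i *v x) + u \<bullet> (matR sys i *v u)"

text \<open>Input sequences are lists; the solution at time \<open>k\<close> only uses their first \<open>k\<close> entries.\<close>

fun solution ::
  "('n::finite, 'm::finite) switched_system \<Rightarrow> nat \<Rightarrow> real^'n \<Rightarrow> (real^'m) list \<Rightarrow> nat list \<Rightarrow> real^'n"
where
  "solution sys 0 x us is = x"
| "solution sys (Suc k) x us is =
     matA sys (is ! k) *v solution sys k x us is + matB sys (is ! k) *v (us ! k)"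

definition terminal_cost :: "real^'n^'n \<Rightarrow> real^'n \<Rightarrow> real" where
  "terminal_cost P0 x = x \<bullet> (P0 *v x)"

definition horizon_cost ::
  "('n::finite, 'm::finite) switched_system \<Rightarrow> real^'n^'n \<Rightarrow> nat \<Rightarrow> real^'n
     \<Rightarrow> (real^'m) list \<Rightarrow> nat list \<Rightarrow> real" where
  "horizon_cost sys P0 d x us is =
     (\<Sum>k<d. stage_cost sys (solution sys k x us is) (us ! k) (is ! k))
     + terminal_cost P0 (solution sys d x us is)"

text \<open>On the reals, \<open>LEAST v. v \<in> X\<close> is the minimum of \<open>X\<close> (an element of \<open>X\<close>, unlike \<open>Inf X\<close>),
  and is unspecified if there is none.\<close>

definition V_circ ::
  "('n::finite, 'm::finite) switched_system \<Rightarrow> real^'n^'n \<Rightarrow> nat \<Rightarrow> real^'n \<Rightarrow> nat list \<Rightarrow> real" where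
  "V_circ sys P0 d x is =
     (LEAST v. v \<in> {horizon_cost sys P0 d x us is | us. length us = d})"

definition V_star ::
  "('n::finite, 'm::finite) switched_system \<Rightarrow> real^'n^'n \<Rightarrow> nat \<Rightarrow> real^'n \<Rightarrow> real" where
  "V_star sys P0 d x = Min (V_circ sys P0 d x ` mode_seqs sys d)"

definition minimizing_seq ::
  "('n::finite, 'm::finite) switched_system \<Rightarrow> real^'n^'n \<Rightarrow> nat \<Rightarrow> real^'n \<Rightarrow> nat list \<Rightarrow> bool" where
  "minimizing_seq sys P0 d x is \<longleftrightarrow>
     is \<in> mode_seqs sys d \<and> V_circ sys P0 d x is = V_star sys P0 d x"


subsection \<open>Riccati operators\<close>

definition riccati ::
  "('n::finite, 'm::finite) switched_system \<Rightarrow> nat \<Rightarrow> real^'n^'n \<Rightarrow> real^'n^'n" where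
  "riccati sys i P =
     (let A = matA sys i; B = matB sys i; Q = matQ sys i; R = matR sys i
      in Q + transpose A ** P ** A
         - transpose A ** P ** B ** matrix_inv (R + transpose B ** P ** B)
             ** transpose B ** P ** A)"

definition riccati_seq ::
  "('n::finite, 'm::finite) switched_system \<Rightarrow> real^'n^'n \<Rightarrow> nat list \<Rightarrow> real^'n^'n" where
  "riccati_seq sys P0 is = foldr (riccati sys) is P0"


subsection \<open>TROOP\<close>

record 'n::finite leaf =
  leaf_seq :: "nat list"
  leaf_mat :: "real^'n^'n"
  leaf_cost :: real

definition make_leaf ::
  "('n::finite, 'm::finite) switched_system \<Rightarrow> real^'n^'n \<Rightarrow> real^'n \<Rightarrow> nat list \<Rightarrow> 'n leaf" where
  "make_leaf sys P0 x is =
     \<lparr> leaf_seq = is,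
       leaf_mat = riccati_seq sys P0 is,
       leaf_cost = x \<bullet> (riccati_seq sys P0 is *v x) \<rparr>"

text \<open>A state of the algorithm after \<open>iteration\<close> passes through the loop; \<open>selected\<close> is the leaf
  expanded in the most recent pass (\<open>None\<close> before the first one). Leaves carry pairwise different
  sequences, so a set of leaves suffices.\<close>

record 'n::finite troop_state =
  iteration :: nat
  leaves :: "'n leaf set"
  selected :: "'n leaf option"

definition troop_init ::
  "('n::finite, 'm::finite) switched_system \<Rightarrow> real^'n^'n \<Rightarrow> real^'n \<Rightarrow> 'n troop_state" where
  "troop_init sys P0 x =
     \<lparr> iteration = 0, leaves = {make_leaf sys P0 x []}, selected = None \<rparr>"

definition troop_halted :: "nat \<Rightarrow> 'n::finite troop_state \<Rightarrow> bool" where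
  "troop_halted d s \<longleftrightarrow> (\<exists>L. selected s = Some L \<and> length (leaf_seq L) = d)"

text \<open>One pass through the loop. It is a relation because ties are broken arbitrarily.\<close>

inductive troop_step ::
  "('n::finite, 'm::finite) switched_system \<Rightarrow> real^'n^'n \<Rightarrow> real^'n \<Rightarrow> nat
     \<Rightarrow> 'n troop_state \<Rightarrow> 'n troop_state \<Rightarrow> bool"
  for sys P0 x d where
  "\<lbrakk> \<not> troop_halted d s; is_arg_min leaf_cost (\<lambda>L. L \<in> leaves s) L \<rbrakk> \<Longrightarrow>
   troop_step sys P0 x d s
     \<lparr> iteration = Suc (iteration s),
       leaves = (leaves s - {L})
                  \<union> (\<lambda>i. make_leaf sys P0 x (leaf_seq L @ [i])) ` modes sys,
       selected = Some L \<rparr>"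

definition troop_reachable ::
  "('n::finite, 'm::finite) switched_system \<Rightarrow> real^'n^'n \<Rightarrow> real^'n \<Rightarrow> nat
     \<Rightarrow> 'n troop_state \<Rightarrow> bool" where
  "troop_reachable sys P0 x d s \<longleftrightarrow> (troop_step sys P0 x d)\<^sup>*\<^sup>* (troop_init sys P0 x) s"

text \<open>Whatever the tie-breaking, the run is not infinite and does not get stuck before the stopping
  test succeeds.\<close>

definition troop_terminates ::
  "('n::finite, 'm::finite) switched_system \<Rightarrow> real^'n^'n \<Rightarrow> real^'n \<Rightarrow> nat \<Rightarrow> bool" where
  "troop_terminates sys P0 x d \<longleftrightarrow>
     (\<nexists>f. f 0 = troop_init sys P0 x \<and> (\<forall>n. troop_step sys P0 x d (f n) (f (Suc n)))) \<and>
     (\<forall>s. troop_reachable sys P0 x d s \<longrightarrow>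
        troop_halted d s \<or> (\<exists>s'. troop_step sys P0 x d s s'))"

text \<open>Some run returns the leaf \<open>S\<close> (with its sequence and cost) and the budget \<open>b\<close>.\<close>

definition troop_returns ::
  "('n::finite, 'm::finite) switched_system \<Rightarrow> real^'n^'n \<Rightarrow> real^'n \<Rightarrow> nat
     \<Rightarrow> 'n leaf \<Rightarrow> nat \<Rightarrow> bool" where
  "troop_returns sys P0 x d S b \<longleftrightarrow>
     (\<exists>s. troop_reachable sys P0 x d s \<and> troop_halted d s \<and> selected s = Some S \<and> iteration s = b)"

definition budget_bound :: "nat \<Rightarrow> nat \<Rightarrow> real" where
  "budget_bound M d =
     (if M = 1 then (\<Sum>k\<le>d. real M ^ k) else (real M ^ (d + 1) - 1) / (real M - 1)) + 1"

end

theory Submission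
  imports Defs
begin

text \<open>
  TROOP is best-first search on the tree of mode sequences, and it is correct because the cost of a
  leaf never exceeds the cost of its descendants.

  Completing the square in \<open>u\<close> shows that \<open>x\<^sup>T \<R>\<^sub>i(P) x\<close> is the minimum over \<open>u\<close> of the one-step
  cost \<open>\<ell>(x, u, i) + x'\<^sup>T P x'\<close> with \<open>x' = A\<^sub>i x + B\<^sub>i u\<close> (\<open>one_step_cost_eq_riccati\<close>). Three facts
  follow. By dynamic programming, \<open>V\<degree>\<^sub>d(x, \<i>) = x\<^sup>T P\<^sub>\<i> x\<close>, so the cost of a leaf is the optimal cost
  of its sequence (\<open>V_circ_eq_riccati_seq\<close>). A minimum of larger functions is larger, so every
  \<open>\<R>\<^sub>i\<close> is monotone in the Loewner order (\<open>riccati_mono\<close>). Finally, the block matrix inequality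
  says that, for the terminal weight \<open>P = P0\<close>, \<open>x\<^sup>T P x\<close> is at most the one-step cost, whatever \<open>x\<close>
  and \<open>u\<close> are; hence \<open>P0 \<preceq> \<R>\<^sub>j(P0)\<close>, and applying the monotone
  operators of a sequence to both sides shows that appending \<open>j\<close> to the sequence cannot lower its
  cost (\<open>riccati_seq_append_ge\<close>).

  As long as TROOP has not halted, its leaves are determined by the set \<open>E\<close> of expanded sequences: they carry
  the sequences that are not in \<open>E\<close> but are empty or have their parent in \<open>E\<close>. All
  sequences in \<open>E\<close> have length below \<open>d\<close>, and each pass adds one new sequence to \<open>E\<close>; there are only
  \<open>1 + M + \<dots> + M\<^sup>d\<^sup>-\<^sup>1\<close> such sequences, and one further pass selects a sequence of length \<open>d\<close>, which
  bounds the budget. Every sequence of length \<open>d\<close> has a prefix among the leaves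
  (\<open>prefix_in_search_frontier\<close>). Hence there is always a leaf to select; and when a sequence of length
  \<open>d\<close> is selected, it is optimal: for any competitor, the prefix costs at least as much as the
  selected leaf and at most as much as the competitor itself.
\<close>


section \<open>Quadratic forms\<close>

lemma inner_transpose_mult:
  fixes A :: "real^'n^'m"
  shows "v \<bullet> (transpose A *v w) = (A *v v) \<bullet> w"
  by (metis dot_lmul_matrix inner_commute transpose_matrix_vector)

lemma symmetric_iff_self_adjoint:
  fixes X :: "real^'n^'n"
  shows "transpose X = X \<longleftrightarrow> (\<forall>v w. v \<bullet> (X *v w) = (X *v v) \<bullet> w)"
proof
  assume "transpose X = X"
  then show "\<forall>v w. v \<bullet> (X *v w) = (X *v v) \<bullet> w"
    by (metis inner_transpose_mult)
next
  assume *: "\<forall>v w. v \<bullet> (X *v w) = (X *v v) \<bullet> w"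
  have "transpose X *v w = X *v w" for w
    by (rule vector_eq_ldot[THEN iffD1]) (metis * inner_transpose_mult)
  then show "transpose X = X"
    by (simp add: matrix_eq del: transpose_matrix_vector)
qed

lemma pos_semidef_self_adjoint:
  "pos_semidef X \<Longrightarrow> v \<bullet> (X *v w) = (X *v v) \<bullet> w"
  unfolding pos_semidef_def symmetric_iff_self_adjoint by blast

lemma pos_semidef_nonneg: "pos_semidef X \<Longrightarrow> 0 \<le> v \<bullet> (X *v v)"
  by (simp add: pos_semidef_def)

lemma pos_def_imp_pos_semidef: "pos_def X \<Longrightarrow> pos_semidef X"
  unfolding pos_def_def pos_semidef_def
  by (metis inner_zero_left less_imp_le order_refl)

lemma pos_def_mult_matrix_inv:
  assumes "pos_def X"
  shows "X *v (matrix_inv X *v v) = v"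
proof -
  have "v = 0" if "X *v v = 0" for v
    using assms that unfolding pos_def_def by (metis inner_zero_right less_irrefl)
  then have "invertible X"
    unfolding invertible_left_inverse matrix_left_invertible_ker by blast
  then have "X ** matrix_inv X = mat 1"
    unfolding invertible_def matrix_inv_def by (rule someI_ex[THEN conjunct1])
  then show ?thesis
    by (simp add: matrix_vector_mul_assoc)
qed

lemma pos_def_add_congruence:
  fixes R :: "real^'m^'m" and P :: "real^'n^'n" and B :: "real^'m^'n"
  assumes "pos_def R" "pos_semidef P"
  shows "pos_def (R + transpose B ** P ** B)"
proof -
  have form: "v \<bullet> ((R + transpose B ** P ** B) *v w) = v \<bullet> (R *v w) + (B *v v) \<bullet> (P *v (B *v w))"
    for v w
    by (simp add: matrix_vector_mult_add_rdistrib inner_add_right inner_transpose_mult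
        flip: matrix_vector_mul_assoc del: transpose_matrix_vector)
  have R: "pos_semidef R"
    using assms(1) by (rule pos_def_imp_pos_semidef)
  have "v \<bullet> ((R + transpose B ** P ** B) *v w) = ((R + transpose B ** P ** B) *v v) \<bullet> w" for v w
    using form[of v w] form[of w v] pos_semidef_self_adjoint[OF R, of v w]
      pos_semidef_self_adjoint[OF assms(2), of "B *v v" "B *v w"]
    by (simp add: inner_commute)
  moreover have "0 < v \<bullet> ((R + transpose B ** P ** B) *v v)" if "v \<noteq> 0" for v
    using assms(1) that pos_semidef_nonneg[OF assms(2), of "B *v v"]
    unfolding form pos_def_def by (simp add: add_pos_nonneg)
  ultimately show ?thesis
    unfolding pos_def_def symmetric_iff_self_adjoint by blast
qed

lemma sum_UNIV_sum_type:
  fixes f :: "'a::finite + 'b::finite \<Rightarrow> 'c::comm_monoid_add"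
  shows "sum f UNIV = (\<Sum>i\<in>UNIV. f (Inl i)) + (\<Sum>j\<in>UNIV. f (Inr j))"
proof -
  have "sum f UNIV = sum f (range Inl \<union> range Inr)"
    by (simp add: UNIV_sum)
  also have "\<dots> = sum f (range Inl) + sum f (range Inr)"
    by (rule sum.union_disjoint) auto
  finally show ?thesis
    by (simp add: sum.reindex)
qed

lemma block_matrix_form:
  fixes X :: "real^'n^'n" and Y :: "real^'m^'n" and Z :: "real^'n^'m" and W :: "real^'m^'m"
  assumes "pos_semidef (block_matrix X Y Z W)"
  shows "0 \<le> v \<bullet> (X *v v) + v \<bullet> (Y *v u) + u \<bullet> (Z *v v) + u \<bullet> (W *v u)"
proof -
  define z :: "real^('n + 'm)" where "z = (\<chi> r. case r of Inl i \<Rightarrow> v $ i | Inr j \<Rightarrow> u $ j)"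
  have "z \<bullet> (block_matrix X Y Z W *v z)
    = v \<bullet> (X *v v) + v \<bullet> (Y *v u) + u \<bullet> (Z *v v) + u \<bullet> (W *v u)"
    unfolding z_def block_matrix_def inner_vec_def matrix_vector_mult_def
    by (simp add: sum_UNIV_sum_type distrib_left sum.distrib)
  then show ?thesis
    using pos_semidef_nonneg[OF assms, of z] by simp
qed


section \<open>The Riccati operator as a one-step minimum\<close>

definition one_step_cost ::
  "('n::finite, 'm::finite) switched_system \<Rightarrow> nat \<Rightarrow> real^'n^'n \<Rightarrow> real^'n \<Rightarrow> real^'m \<Rightarrow> real" where
  "one_step_cost sys i P x u =
     stage_cost sys x u i + terminal_cost P (matA sys i *v x + matB sys i *v u)"

text \<open>Completing the square, with Hessian \<open>R + B\<^sup>T P B\<close> and minimizer \<open>u = - w\<close>.\<close>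

lemma one_step_cost_eq_riccati:
  fixes sys :: "('n::finite, 'm::finite) switched_system"
    and P :: "real^'n^'n" and i :: nat
  defines "S \<equiv> matR sys i + transpose (matB sys i) ** P ** matB sys i"
  assumes "pos_def (matR sys i)" "pos_semidef P"
  obtains w where
    "\<And>u. one_step_cost sys i P x u = x \<bullet> (riccati sys i P *v x) + (u + w) \<bullet> (S *v (u + w))"
proof -
  define A B Q R where "A = matA sys i" and "B = matB sys i" and "Q = matQ sys i" and "R = matR sys i"
  note defs = A_def B_def Q_def R_def
  define y where "y = A *v x"
  define g where "g = transpose B *v (P *v y)"
  define w where "w = matrix_inv S *v g"
  have S: "pos_def S"
    unfolding S_def using assms by (intro pos_def_add_congruence)
  have S_eq: "S = R + transpose B ** P ** B"
    by (simp add: S_def defs)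
  have Sw: "S *v w = g"
    unfolding w_def by (rule pos_def_mult_matrix_inv[OF S])
  have g_inner: "v \<bullet> g = (B *v v) \<bullet> (P *v y)" for v
    unfolding g_def by (rule inner_transpose_mult)
  have y_inner: "y \<bullet> (P *v (B *v v)) = v \<bullet> g" for v
    using pos_semidef_self_adjoint[OF assms(3), of y "B *v v"] by (metis g_inner inner_commute)
  have "riccati sys i P *v x = Q *v x + transpose A *v (P *v y) - transpose A *v (P *v (B *v w))"
    unfolding riccati_def Let_def w_def g_def y_def S_eq defs
    by (simp add: matrix_vector_mult_add_rdistrib matrix_vector_mult_diff_rdistrib
        flip: matrix_vector_mul_assoc del: transpose_matrix_vector)
  then have "x \<bullet> (riccati sys i P *v x) = x \<bullet> (Q *v x) + y \<bullet> (P *v y) - y \<bullet> (P *v (B *v w))"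
    by (simp add: inner_add_right inner_diff_right inner_transpose_mult y_def
        del: transpose_matrix_vector)
  then have ric: "x \<bullet> (riccati sys i P *v x) = x \<bullet> (Q *v x) + y \<bullet> (P *v y) - w \<bullet> g"
    by (simp add: y_inner)
  have "one_step_cost sys i P x u = x \<bullet> (riccati sys i P *v x) + (u + w) \<bullet> (S *v (u + w))" for u
  proof -
    have "w \<bullet> (S *v u) = u \<bullet> g"
      using pos_semidef_self_adjoint[OF pos_def_imp_pos_semidef[OF S], of w u]
      by (simp add: Sw inner_commute)
    then have "(u + w) \<bullet> (S *v (u + w)) = u \<bullet> (S *v u) + 2 * (u \<bullet> g) + w \<bullet> g"
      by (simp add: matrix_vector_right_distrib inner_add_left inner_add_right Sw)
    moreover have "u \<bullet> (S *v u) = u \<bullet> (R *v u) + (B *v u) \<bullet> (P *v (B *v u))"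
      by (simp add: S_eq matrix_vector_mult_add_rdistrib inner_add_right inner_transpose_mult
          flip: matrix_vector_mul_assoc del: transpose_matrix_vector)
    ultimately show ?thesis
      unfolding one_step_cost_def stage_cost_def terminal_cost_def ric
      by (simp add: g_inner y_inner matrix_vector_right_distrib inner_add_left inner_add_right
          flip: defs y_def)
  qed
  then show thesis
    using that by blast
qed

lemma riccati_le_one_step_cost:
  assumes "pos_def (matR sys i)" "pos_semidef P"
  shows "x \<bullet> (riccati sys i P *v x) \<le> one_step_cost sys i P x u"
proof -
  obtain w where "one_step_cost sys i P x u = x \<bullet> (riccati sys i P *v x)
      + (u + w) \<bullet> ((matR sys i + transpose (matB sys i) ** P ** matB sys i) *v (u + w))"
    using one_step_cost_eq_riccati[OF assms, of x] by blast
  then show ?thesis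
    using pos_semidef_nonneg[OF pos_def_imp_pos_semidef[OF pos_def_add_congruence[OF assms]]]
    by simp
qed

lemma riccati_attained:
  assumes "pos_def (matR sys i)" "pos_semidef P"
  obtains u where "one_step_cost sys i P x u = x \<bullet> (riccati sys i P *v x)"
proof -
  obtain w where "\<And>u. one_step_cost sys i P x u = x \<bullet> (riccati sys i P *v x)
      + (u + w) \<bullet> ((matR sys i + transpose (matB sys i) ** P ** matB sys i) *v (u + w))"
    using one_step_cost_eq_riccati[OF assms, of x] by blast
  from this[of "- w"] show thesis
    by (intro that[of "- w"]) simp
qed

lemma pos_semidef_riccati:
  fixes sys :: "('n::finite, 'm::finite) switched_system"
  assumes "pos_def (matQ sys i)" "pos_def (matR sys i)" "pos_semidef P"
  shows "pos_semidef (riccati sys i P)"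
proof -
  define A B Q R where "A = matA sys i" and "B = matB sys i" and "Q = matQ sys i" and "R = matR sys i"
  note defs = A_def B_def Q_def R_def
  define S where "S = R + transpose B ** P ** B"
  define g where "g = (\<lambda>x. transpose B *v (P *v (A *v x)))"
  have S: "pos_def S"
    unfolding S_def R_def using assms by (intro pos_def_add_congruence)
  note S_psd = pos_def_imp_pos_semidef[OF S]
  have Q_psd: "pos_semidef Q"
    using assms(1) unfolding Q_def by (rule pos_def_imp_pos_semidef)
  have form: "v \<bullet> (riccati sys i P *v w) =
    v \<bullet> (Q *v w) + (A *v v) \<bullet> (P *v (A *v w)) - g v \<bullet> (matrix_inv S *v g w)" for v w
  proof -
    have "(A *v v) \<bullet> (P *v (B *v z)) = g v \<bullet> z" for z
      using inner_transpose_mult[of z B "P *v (A *v v)"]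
        pos_semidef_self_adjoint[OF assms(3), of "A *v v" "B *v z"]
      by (simp add: g_def inner_commute del: transpose_matrix_vector)
    then show ?thesis
      unfolding riccati_def Let_def S_def g_def defs
      by (simp add: matrix_vector_mult_add_rdistrib matrix_vector_mult_diff_rdistrib
          inner_add_right inner_diff_right inner_transpose_mult
          flip: matrix_vector_mul_assoc del: transpose_matrix_vector)
  qed
  have inv_sym: "a \<bullet> (matrix_inv S *v b) = b \<bullet> (matrix_inv S *v a)" for a b
    using pos_semidef_self_adjoint[OF S_psd, of "matrix_inv S *v a" "matrix_inv S *v b"]
    by (simp add: pos_def_mult_matrix_inv[OF S] inner_commute)
  have "v \<bullet> (riccati sys i P *v w) = w \<bullet> (riccati sys i P *v v)" for v w
    unfolding form
    using inv_sym[of "g v" "g w"] pos_semidef_self_adjoint[OF Q_psd, of v w]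
      pos_semidef_self_adjoint[OF assms(3), of "A *v v" "A *v w"]
    by (simp add: inner_commute)
  then have "transpose (riccati sys i P) = riccati sys i P"
    unfolding symmetric_iff_self_adjoint by (metis inner_commute)
  moreover have "0 \<le> x \<bullet> (riccati sys i P *v x)" for x
  proof -
    obtain u where "one_step_cost sys i P x u = x \<bullet> (riccati sys i P *v x)"
      using riccati_attained[OF assms(2,3)] .
    moreover have "0 \<le> one_step_cost sys i P x u"
      unfolding one_step_cost_def stage_cost_def terminal_cost_def
      using assms by (simp add: pos_semidef_nonneg pos_def_imp_pos_semidef)
    ultimately show ?thesis
      by simp
  qed
  ultimately show ?thesis
    unfolding pos_semidef_def by blast
qed

text \<open>The optimal input for the larger matrix is a candidate input for the smaller one.\<close>

lemma riccati_mono: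
  assumes "pos_def (matR sys i)" "pos_semidef P" "pos_semidef P'"
    and "\<And>v. v \<bullet> (P *v v) \<le> v \<bullet> (P' *v v)"
  shows "x \<bullet> (riccati sys i P *v x) \<le> x \<bullet> (riccati sys i P' *v x)"
proof -
  obtain u where "one_step_cost sys i P' x u = x \<bullet> (riccati sys i P' *v x)"
    using riccati_attained[OF assms(1,3)] .
  moreover have "one_step_cost sys i P x u \<le> one_step_cost sys i P' x u"
    by (simp add: one_step_cost_def terminal_cost_def assms(4))
  ultimately show ?thesis
    using riccati_le_one_step_cost[OF assms(1,2), of x u] by linarith
qed

text \<open>The quadratic form of the block matrix at \<open>(x, u)\<close> is the difference between the one-step
  cost and \<open>x\<^sup>T P x\<close>; the bound then holds in particular for the optimal \<open>u\<close>.\<close>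

lemma riccati_ge:
  fixes sys :: "('n::finite, 'm::finite) switched_system"
  assumes "pos_def (matR sys i)" "pos_semidef P"
    and "pos_semidef (block_matrix
           (transpose (matA sys i) ** P ** matA sys i - P + matQ sys i)
           (transpose (matA sys i) ** P ** matB sys i)
           (transpose (matB sys i) ** P ** matA sys i)
           (matR sys i + transpose (matB sys i) ** P ** matB sys i))"
  shows "x \<bullet> (P *v x) \<le> x \<bullet> (riccati sys i P *v x)"
proof -
  obtain u where "one_step_cost sys i P x u = x \<bullet> (riccati sys i P *v x)"
    using riccati_attained[OF assms(1,2)] .
  moreover have "x \<bullet> (P *v x) \<le> one_step_cost sys i P x u"
    using block_matrix_form[OF assms(3), of x u]
    by (simp add: one_step_cost_def stage_cost_def terminal_cost_def
        matrix_vector_mult_add_rdistrib matrix_vector_mult_diff_rdistrib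
        matrix_vector_right_distrib inner_add_left inner_add_right inner_diff_right
        inner_transpose_mult flip: matrix_vector_mul_assoc del: transpose_matrix_vector)
  ultimately show ?thesis
    by simp
qed


section \<open>Dynamic programming\<close>

lemma riccati_seq_Nil [simp]: "riccati_seq sys P0 [] = P0"
  and riccati_seq_Cons [simp]:
    "riccati_seq sys P0 (i # ms) = riccati sys i (riccati_seq sys P0 ms)"
  by (simp_all add: riccati_seq_def)

lemma solution_Cons:
  "solution sys (Suc k) x (u # us) (i # ms)
   = solution sys k (matA sys i *v x + matB sys i *v u) us ms"
  by (induction k) simp_all

lemma horizon_cost_Cons:
  "horizon_cost sys P0 (Suc d) x (u # us) (i # ms)
   = stage_cost sys x u i + horizon_cost sys P0 d (matA sys i *v x + matB sys i *v u) us ms"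
  unfolding horizon_cost_def sum.lessThan_Suc_shift solution_Cons by simp

lemma finite_mode_seqs: "finite (mode_seqs sys k)"
  using finite_lists_length_eq[of "modes sys" k]
  by (simp add: mode_seqs_def modes_def conj_commute)

lemma card_mode_seqs: "card (mode_seqs sys k) = num_modes sys ^ k"
  using card_lists_length_eq[of "modes sys" k]
  by (simp add: mode_seqs_def modes_def conj_commute)

context
  fixes sys :: "('n::finite, 'm::finite) switched_system" and P0 :: "real^'n^'n"
  assumes Q_pos: "\<And>i. i \<in> modes sys \<Longrightarrow> pos_def (matQ sys i)"
    and R_pos: "\<And>i. i \<in> modes sys \<Longrightarrow> pos_def (matR sys i)"
    and P0_psd: "pos_semidef P0"
begin

lemma pos_semidef_riccati_seq:
  "set ms \<subseteq> modes sys \<Longrightarrow> pos_semidef (riccati_seq sys P0 ms)"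
  by (induction ms) (simp_all add: P0_psd pos_semidef_riccati Q_pos R_pos)

lemma riccati_seq_le_horizon_cost:
  assumes "set ms \<subseteq> modes sys" "length us = length ms"
  shows "x \<bullet> (riccati_seq sys P0 ms *v x) \<le> horizon_cost sys P0 (length ms) x us ms"
  using assms(2,1)
proof (induction us ms arbitrary: x rule: list_induct2)
  case Nil
  then show ?case
    by (simp add: horizon_cost_def terminal_cost_def)
next
  case (Cons u us i ms)
  let ?x' = "matA sys i *v x + matB sys i *v u"
  have "x \<bullet> (riccati_seq sys P0 (i # ms) *v x) \<le> one_step_cost sys i (riccati_seq sys P0 ms) x u"
    using Cons.prems by (simp add: riccati_le_one_step_cost R_pos pos_semidef_riccati_seq)
  also have "\<dots> \<le> stage_cost sys x u i + horizon_cost sys P0 (length ms) ?x' us ms"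
    using Cons.IH[of ?x'] Cons.prems by (simp add: one_step_cost_def terminal_cost_def)
  finally show ?case
    by (simp add: horizon_cost_Cons)
qed

lemma riccati_seq_attained:
  assumes "set ms \<subseteq> modes sys"
  shows "\<exists>us. length us = length ms \<and>
    horizon_cost sys P0 (length ms) x us ms = x \<bullet> (riccati_seq sys P0 ms *v x)"
  using assms
proof (induction ms arbitrary: x)
  case Nil
  then show ?case
    by (simp add: horizon_cost_def terminal_cost_def)
next
  case (Cons i ms)
  then have "pos_def (matR sys i)" "pos_semidef (riccati_seq sys P0 ms)"
    by (simp_all add: R_pos pos_semidef_riccati_seq)
  then obtain u where u: "one_step_cost sys i (riccati_seq sys P0 ms) x u
      = x \<bullet> (riccati sys i (riccati_seq sys P0 ms) *v x)"
    by (rule riccati_attained)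
  let ?x' = "matA sys i *v x + matB sys i *v u"
  obtain us where "length us = length ms"
    "horizon_cost sys P0 (length ms) ?x' us ms = ?x' \<bullet> (riccati_seq sys P0 ms *v ?x')"
    using Cons.IH[of ?x'] Cons.prems by auto
  with u show ?case
    by (intro exI[of _ "u # us"]) (simp add: horizon_cost_Cons one_step_cost_def terminal_cost_def)
qed

lemma V_circ_eq_riccati_seq:
  assumes "set ms \<subseteq> modes sys"
  shows "V_circ sys P0 (length ms) x ms = x \<bullet> (riccati_seq sys P0 ms *v x)"
  unfolding V_circ_def
proof (rule Least_equality)
  show "x \<bullet> (riccati_seq sys P0 ms *v x)
    \<in> {horizon_cost sys P0 (length ms) x us ms |us. length us = length ms}"
    using riccati_seq_attained[OF assms, of x] by force
next
  fix v
  assume "v \<in> {horizon_cost sys P0 (length ms) x us ms |us. length us = length ms}"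
  then show "x \<bullet> (riccati_seq sys P0 ms *v x) \<le> v"
    using riccati_seq_le_horizon_cost[OF assms] by blast
qed

text \<open>The matrix of \<open>ms @ ns\<close> arises by applying the operators of \<open>ns\<close> first. Each of them keeps the
  matrix above \<open>P0\<close>, and monotonicity carries this bound outwards through the operators of
  \<open>ms\<close>.\<close>

lemma riccati_seq_append_ge:
  assumes ge: "\<And>i v. i \<in> modes sys \<Longrightarrow> v \<bullet> (P0 *v v) \<le> v \<bullet> (riccati sys i P0 *v v)"
    and "set (ms @ ns) \<subseteq> modes sys"
  shows "x \<bullet> (riccati_seq sys P0 ms *v x) \<le> x \<bullet> (riccati_seq sys P0 (ms @ ns) *v x)"
  using assms(2)
proof (induction ms arbitrary: x)
  case Nil
  then have "set ns \<subseteq> modes sys"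
    by simp
  then have "x \<bullet> (P0 *v x) \<le> x \<bullet> (riccati_seq sys P0 ns *v x)" for x
  proof (induction ns arbitrary: x)
    case (Cons i ns)
    then have "x \<bullet> (P0 *v x) \<le> x \<bullet> (riccati sys i P0 *v x)"
      by (simp add: ge)
    also have "\<dots> \<le> x \<bullet> (riccati sys i (riccati_seq sys P0 ns) *v x)"
      using Cons by (intro riccati_mono R_pos P0_psd pos_semidef_riccati_seq) simp_all
    finally show ?case
      by simp
  qed simp
  then show ?case
    by simp
next
  case (Cons i ms)
  then show ?case
    by (auto intro!: riccati_mono R_pos pos_semidef_riccati_seq)
qed

end


section \<open>Best-first search\<close>

text \<open>The sequences that can be expanded next, once the sequences in \<open>E\<close> have been expanded.\<close>

definition search_frontier :: "nat set \<Rightarrow> nat list set \<Rightarrow> nat list set" where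
  "search_frontier \<Sigma> E = ({[]} \<union> {p @ [i] | p i. p \<in> E \<and> i \<in> \<Sigma>}) - E"

lemma prefix_in_search_frontier:
  assumes "set ms \<subseteq> \<Sigma>" "ms \<notin> E"
  shows "\<exists>p q. ms = p @ q \<and> p \<in> search_frontier \<Sigma> E"
  using assms
proof (induction ms rule: rev_induct)
  case Nil
  then show ?case
    by (simp add: search_frontier_def)
next
  case (snoc i ms)
  show ?case
  proof (cases "ms \<in> E")
    case True
    with snoc.prems have "ms @ [i] \<in> search_frontier \<Sigma> E"
      by (auto simp: search_frontier_def)
    then show ?thesis
      by (intro exI[of _ "ms @ [i]"] exI[of _ "[]"]) simp
  next
    case False
    then obtain p q where "ms = p @ q" "p \<in> search_frontier \<Sigma> E"
      using snoc by auto
    then show ?thesis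
      by (intro exI[of _ p] exI[of _ "q @ [i]"]) simp
  qed
qed

text \<open>Closure under prefixes guarantees that no child of the new sequence \<open>e\<close> is already in
  \<open>E\<close>.\<close>

lemma search_frontier_insert:
  assumes "e \<in> search_frontier \<Sigma> E" and closed: "\<And>p i. p @ [i] \<in> E \<Longrightarrow> p \<in> E"
  shows "search_frontier \<Sigma> (insert e E) = (search_frontier \<Sigma> E - {e}) \<union> (\<lambda>i. e @ [i]) ` \<Sigma>"
  using assms unfolding search_frontier_def by blast

text \<open>The loop invariant up to halting: the leaves and the iteration count are functions of the set
  \<open>E\<close> of expanded sequences. Their length stays below \<open>d\<close> because expanding a sequence of length \<open>d\<close> ends the
  run.\<close>

definition troop_expanded ::
  "('n::finite, 'm::finite) switched_system \<Rightarrow> real^'n^'n \<Rightarrow> real^'n \<Rightarrow> nat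
     \<Rightarrow> nat list set \<Rightarrow> 'n troop_state \<Rightarrow> bool" where
  "troop_expanded sys P0 x d E s \<longleftrightarrow>
     iteration s = card E \<and> leaves s = make_leaf sys P0 x ` search_frontier (modes sys) E \<and>
     E \<subseteq> (\<Union>k<d. mode_seqs sys k) \<and> (\<forall>p i. p @ [i] \<in> E \<longrightarrow> p \<in> E)"

lemma leaf_seq_make_leaf [simp]: "leaf_seq (make_leaf sys P0 x ms) = ms"
  by (simp add: make_leaf_def)

lemma inj_make_leaf: "inj (make_leaf sys P0 x)"
  by (rule inj_on_inverseI) (rule leaf_seq_make_leaf)

lemma search_frontier_modes_length:
  assumes "troop_expanded sys P0 x d E s" "e \<in> search_frontier (modes sys) E"
  shows "set e \<subseteq> modes sys" "length e \<le> d"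
  using assms unfolding troop_expanded_def search_frontier_def mode_seqs_def by force+

lemma troop_expanded_bound:
  assumes "troop_expanded sys P0 x d E s"
  shows "finite E" "card E \<le> (\<Sum>k<d. num_modes sys ^ k)"
proof -
  have E: "E \<subseteq> (\<Union>k<d. mode_seqs sys k)"
    using assms by (simp add: troop_expanded_def)
  have fin: "finite (\<Union>k<d. mode_seqs sys k)"
    by (simp add: finite_mode_seqs)
  show "finite E"
    using E fin by (rule finite_subset)
  have "card E \<le> card (\<Union>k<d. mode_seqs sys k)"
    using fin E by (rule card_mono)
  also have "\<dots> \<le> (\<Sum>k<d. card (mode_seqs sys k))"
    by (rule card_UN_le) simp
  finally show "card E \<le> (\<Sum>k<d. num_modes sys ^ k)"
    by (simp add: card_mode_seqs)
qed

text \<open>The halting pass expands a sequence of length \<open>d\<close> and so leaves the invariant; a halted state is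
  therefore described through the state \<open>s'\<close> before that pass, where the selected leaf still competes
  with all others.\<close>

lemma troop_reachable_cases:
  assumes "troop_reachable sys P0 x d s"
  shows "(\<not> troop_halted d s \<and> (\<exists>E. troop_expanded sys P0 x d E s)) \<or>
    (\<exists>E s' e. troop_expanded sys P0 x d E s' \<and> e \<in> search_frontier (modes sys) E \<and> length e = d \<and>
       is_arg_min leaf_cost (\<lambda>L. L \<in> leaves s') (make_leaf sys P0 x e) \<and>
       selected s = Some (make_leaf sys P0 x e) \<and> iteration s = Suc (card E))"
  using assms unfolding troop_reachable_def
proof (induction rule: rtranclp_induct)
  case base
  have "troop_expanded sys P0 x d {} (troop_init sys P0 x)"
    by (simp add: troop_expanded_def troop_init_def search_frontier_def)
  moreover have "\<not> troop_halted d (troop_init sys P0 x)"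
    by (simp add: troop_halted_def troop_init_def)
  ultimately show ?case
    by blast
next
  case (step s t)
  from step.hyps(2) obtain L where nh: "\<not> troop_halted d s"
    and L: "is_arg_min leaf_cost (\<lambda>L. L \<in> leaves s) L"
    and t: "t = \<lparr> iteration = Suc (iteration s),
       leaves = (leaves s - {L}) \<union> (\<lambda>i. make_leaf sys P0 x (leaf_seq L @ [i])) ` modes sys,
       selected = Some L \<rparr>"
    by (auto elim: troop_step.cases)
  have "\<exists>E. troop_expanded sys P0 x d E s"
    using step.IH nh by (auto simp: troop_halted_def)
  then obtain E where E: "troop_expanded sys P0 x d E s" ..
  then obtain e where e: "e \<in> search_frontier (modes sys) E" "L = make_leaf sys P0 x e"
    using L by (auto simp: troop_expanded_def is_arg_min_def)
  show ?case
  proof (cases "length e = d")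
    case True
    then show ?thesis
      using E e L t by (intro disjI2 exI[of _ E] exI[of _ s] exI[of _ e])
        (simp add: troop_expanded_def)
  next
    case False
    have closed: "\<And>p i. p @ [i] \<in> E \<Longrightarrow> p \<in> E"
      using E by (auto simp: troop_expanded_def)
    have frontier: "search_frontier (modes sys) (insert e E)
      = (search_frontier (modes sys) E - {e}) \<union> (\<lambda>i. e @ [i]) ` modes sys"
      using e(1) closed by (rule search_frontier_insert)
    have "e \<in> (\<Union>k<d. mode_seqs sys k)"
      using search_frontier_modes_length[OF E e(1)] False by (simp add: mode_seqs_def)
    moreover have "e \<notin> E" and "\<And>p i. e = p @ [i] \<Longrightarrow> p \<in> E"
      using e(1) by (auto simp: search_frontier_def)
    moreover have "leaves t = make_leaf sys P0 x ` search_frontier (modes sys) (insert e E)"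
      using E e(2) unfolding frontier troop_expanded_def t
      by (simp add: image_Un image_set_diff[OF inj_make_leaf] image_image)
    ultimately have "troop_expanded sys P0 x d (insert e E) t"
      using E troop_expanded_bound(1)[OF E] t by (auto simp: troop_expanded_def)
    moreover have "\<not> troop_halted d t"
      using False e(2) t by (simp add: troop_halted_def)
    ultimately show ?thesis
      by blast
  qed
qed

text \<open>There is a leaf to select because any sequence of length \<open>d\<close> is unexpanded and so has a prefix
  on the frontier.\<close>

lemma troop_not_stuck:
  assumes "num_modes sys > 0" "\<not> troop_halted d s" "troop_expanded sys P0 x d E s"
  shows "\<exists>t. troop_step sys P0 x d s t"
proof -
  have "finite (insert [] ((\<lambda>(p, i). p @ [i]) ` (E \<times> modes sys)))"
    using troop_expanded_bound(1)[OF assms(3)] by (simp add: modes_def)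
  moreover have "search_frontier (modes sys) E \<subseteq> insert [] ((\<lambda>(p, i). p @ [i]) ` (E \<times> modes sys))"
    by (auto simp: search_frontier_def)
  ultimately have "finite (search_frontier (modes sys) E)"
    by (rule finite_subset[rotated])
  moreover have "search_frontier (modes sys) E \<noteq> {}"
  proof -
    have "replicate d 1 \<notin> E" "set (replicate d 1) \<subseteq> modes sys"
      using assms by (auto simp: troop_expanded_def mode_seqs_def modes_def)
    then show ?thesis
      using prefix_in_search_frontier by blast
  qed
  ultimately have "\<exists>L. is_arg_min leaf_cost (\<lambda>L. L \<in> leaves s) L"
    using assms(3) unfolding troop_expanded_def by (intro ex_is_arg_min_if_finite) simp_all
  then show ?thesis
    using assms(2) troop_step.intros by blast
qed

lemma troop_terminates:
  fixes sys :: "('n::finite, 'm::finite) switched_system"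
  assumes "num_modes sys > 0"
  shows "troop_terminates sys P0 x d"
  unfolding troop_terminates_def
proof (intro conjI allI impI notI)
  assume "\<exists>f. f 0 = troop_init sys P0 x \<and> (\<forall>n. troop_step sys P0 x d (f n) (f (Suc n)))"
  then obtain f where f0: "f 0 = troop_init sys P0 x"
    and step: "\<And>n. troop_step sys P0 x d (f n) (f (Suc n))"
    by blast
  have reach: "troop_reachable sys P0 x d (f n)" for n
  proof (induction n)
    case 0
    then show ?case
      by (simp add: troop_reachable_def f0)
  next
    case (Suc n)
    then show ?case
      unfolding troop_reachable_def using step[of n] by simp
  qed
  have "iteration (f n) = n" for n
  proof (induction n)
    case 0
    then show ?case
      by (simp add: f0 troop_init_def)
  next
    case (Suc n)
    then show ?case
      using step[of n] by (auto elim: troop_step.cases)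
  qed
  moreover have "iteration (f n) \<le> (\<Sum>k<d. num_modes sys ^ k)" for n
  proof -
    have "\<not> troop_halted d (f n)"
      using step[of n] by (auto elim: troop_step.cases)
    then obtain E where E: "troop_expanded sys P0 x d E (f n)"
      using troop_reachable_cases[OF reach[of n]] by (auto simp: troop_halted_def)
    then show ?thesis
      using troop_expanded_bound(2)[OF E] by (simp add: troop_expanded_def)
  qed
  ultimately show False
    by (metis not_less_eq_eq order_refl)
next
  fix s
  assume "troop_reachable sys P0 x d s"
  from troop_reachable_cases[OF this]
  show "troop_halted d s \<or> (\<exists>t. troop_step sys P0 x d s t)"
  proof
    assume "\<not> troop_halted d s \<and> (\<exists>E. troop_expanded sys P0 x d E s)"
    then show ?thesis
      using troop_not_stuck[OF assms] by blast
  qed (auto simp: troop_halted_def)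
qed

lemma budget_bound_eq: "budget_bound M d = real (\<Sum>k\<le>d. M ^ k) + 1"
  using geometric_sum[of "real M" "Suc d"]
  by (simp add: budget_bound_def lessThan_Suc_atMost)

theorem proposition4:
  fixes sys :: "('n::finite, 'm::finite) switched_system"
    and P0 :: "real^'n^'n" and x :: "real^'n" and d :: nat
  assumes "num_modes sys > 0"
    and "\<And>i. i \<in> modes sys \<Longrightarrow> pos_def (matQ sys i)"
    and "\<And>i. i \<in> modes sys \<Longrightarrow> pos_def (matR sys i)"
    and "pos_semidef P0"
    and "\<And>i. i \<in> modes sys \<Longrightarrow> pos_semidef (block_matrix
           (transpose (matA sys i) ** P0 ** matA sys i - P0 + matQ sys i)
           (transpose (matA sys i) ** P0 ** matB sys i)
           (transpose (matB sys i) ** P0 ** matA sys i)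
           (matR sys i + transpose (matB sys i) ** P0 ** matB sys i))"
  shows "troop_terminates sys P0 x d \<and>
    (\<forall>S b. troop_returns sys P0 x d S b \<longrightarrow>
       real b \<le> budget_bound (num_modes sys) d \<and>
       minimizing_seq sys P0 d x (leaf_seq S) \<and>
       leaf_cost S = V_star sys P0 d x)"
proof (intro conjI[OF troop_terminates[OF assms(1)]] allI impI)
  fix S b
  assume "troop_returns sys P0 x d S b"
  then obtain s where "troop_reachable sys P0 x d s" "troop_halted d s"
    and S: "selected s = Some S" and b: "iteration s = b"
    unfolding troop_returns_def by blast
  then obtain E s' e where E: "troop_expanded sys P0 x d E s'"
    and e: "e \<in> search_frontier (modes sys) E" "length e = d"
    and min: "is_arg_min leaf_cost (\<lambda>L. L \<in> leaves s') (make_leaf sys P0 x e)"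
    and "selected s = Some (make_leaf sys P0 x e)" and "iteration s = Suc (card E)"
    using troop_reachable_cases by blast
  then have S_eq: "S = make_leaf sys P0 x e" and b_eq: "b = Suc (card E)"
    using S b by simp_all
  define cost where "cost = (\<lambda>ms. x \<bullet> (riccati_seq sys P0 ms *v x))"
  have leaf_cost: "leaf_cost (make_leaf sys P0 x ms) = cost ms" for ms
    by (simp add: make_leaf_def cost_def)

  have "card E \<le> (\<Sum>k\<le>d. num_modes sys ^ k)"
    using troop_expanded_bound(2)[OF E] by (simp flip: lessThan_Suc_atMost)
  then have budget: "real b \<le> budget_bound (num_modes sys) d"
    unfolding budget_bound_eq b_eq by (simp flip: of_nat_sum of_nat_power)

  have e_modes: "e \<in> mode_seqs sys d"
    using search_frontier_modes_length(1)[OF E e(1)] e(2) by (simp add: mode_seqs_def)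
  have V: "V_circ sys P0 d x ms = cost ms" if "ms \<in> mode_seqs sys d" for ms
    using that V_circ_eq_riccati_seq[OF assms(2-4), where ms = ms and x = x]
    by (auto simp: mode_seqs_def cost_def)
  have "cost e \<le> cost ms" if ms: "ms \<in> mode_seqs sys d" for ms
  proof -
    have "ms \<notin> E"
      using E ms by (auto simp: troop_expanded_def mode_seqs_def)
    then obtain p q where pq: "ms = p @ q" "p \<in> search_frontier (modes sys) E"
      using prefix_in_search_frontier[of ms "modes sys" E] ms by (auto simp: mode_seqs_def)
    have "make_leaf sys P0 x p \<in> leaves s'"
      using E pq(2) by (simp add: troop_expanded_def)
    then have "cost e \<le> cost p"
      using min unfolding is_arg_min_linorder by (metis leaf_cost)
    also have "cost p \<le> cost (p @ q)"
      unfolding cost_def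
    proof (rule riccati_seq_append_ge[OF assms(2-4)])
      show "v \<bullet> (P0 *v v) \<le> v \<bullet> (riccati sys i P0 *v v)" if "i \<in> modes sys" for i v
        using that by (intro riccati_ge assms)
      show "set (p @ q) \<subseteq> modes sys"
        using ms pq(1) by (simp add: mode_seqs_def)
    qed
    finally show ?thesis
      using pq(1) by simp
  qed
  then have "V_star sys P0 d x = cost e"
    unfolding V_star_def using e_modes V by (intro Min_eqI) (auto simp: finite_mode_seqs)
  then show "real b \<le> budget_bound (num_modes sys) d \<and>
       minimizing_seq sys P0 d x (leaf_seq S) \<and> leaf_cost S = V_star sys P0 d x"
    using budget e_modes V unfolding minimizing_seq_def S_eq by (simp add: leaf_cost)
qed

end
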